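(* Let $m$ and $n$ be positive integers. Assume that a sequence $\{u_i\}_{i=1}^{+\infty}$ converges weakly* in $(L_\mu^\infty({\bf R}^n))^m$ to $u$ as $i$ goes to infinity. Assume that all the values of $u$ and $u_i$ ($i=1,2,3,\dots$) belong to a convex set $K$ of ${\bf R}^m$ and that $f(w)$ is a nonnegative continuous convex function from $K$ to ${\bf R}$. Then $$\liminf_{i\to+\infty}\int_{\Omega}f(u_i)\,d\mu\geq\int_{\Omega}f(u)\,d\mu$$ for any measurable set $\Omega\subseteq{\bf R}^n$.
   Context: $\mu$ is the (nonnegative) Lebesgue measure on ${\bf R}^n$. $L_\mu^\infty({\bf R}^n)$ is the Banach space of real-valued measurable functions $\hat u$ on ${\bf R}^n$ with finite norm $\|\hat u\|_\infty=\operatorname{ess\,sup}_{x\in{\bf R}^n}|\hat u(x)|$. $(L_\mu^\infty({\bf R}^n))^m$ is the Banach space of vector-valued functions $u=(\hat u^{(1)},\dots,\hat u^{(m)})$ with all components in $L_\mu^\infty({\bf R}^n)$, with norm $\|u\|_\infty=\sum_{j=1}^m\|\hat u^{(j)}\|_\infty$. A sequence $\{\hat u_i\}$ in $L_\mu^\infty({\bf R}^n)$ converges weakly* to $\hat u\in L_\mu^\infty({\bf R}^n)$ if $\lim_{i\to\infty}\int_{{\bf R}^n}\hat u_i\hat v\,d\mu=\int_{{\bf R}^n}\hat u\hat v\,d\mu$ for all $\hat v\in L_\mu^1({\bf R}^n)$. A sequence $u_i=(\hat u_i^{(1)},\dots,\hat u_i^{(m)})$ converges weakly* in $(L_\mu^\infty({\bf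 R}^n))^m$ to $u=(\hat u^{(1)},\dots,\hat u^{(m)})$ if, for each $j=1,\dots,m$, $\hat u_i^{(j)}$ converges weakly* in $L_\mu^\infty({\bf R}^n)$ to $\hat u^{(j)}$ as $i\to\infty$. Integrals of nonnegative functions may take the value $+\infty$. *)

theory Defs
  imports "HOL-Probability.Essential_Supremum" "HOL-Analysis.Analysis"
begin

text \<open>
  Elements of the Lebesgue spaces are represented by functions rather than by classes modulo
  null sets. Measurability and integrals refer to \<^const>\<open>lebesgue\<close>, the completed measure.
\<close>

definition Linfty :: "(real ^ 'n \<Rightarrow> real) set" where
  "Linfty = {u. u \<in> borel_measurable lebesgue \<and> esssup lebesgue (\<lambda>x. ereal \<bar>u x\<bar>) < \<infinity>}"

definition Linfty_vec :: "(real ^ 'n \<Rightarrow> real ^ 'm) set" where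
  "Linfty_vec = {u. \<forall>j. (\<lambda>x. u x $ j) \<in> Linfty}"

definition weak_star_tendsto ::
    "(nat \<Rightarrow> real ^ 'n \<Rightarrow> real) \<Rightarrow> (real ^ 'n \<Rightarrow> real) \<Rightarrow> bool" where
  "weak_star_tendsto U u \<longleftrightarrow>
     (\<forall>v. integrable lebesgue v \<longrightarrow>
        (\<lambda>i. \<integral>x. U i x * v x \<partial>lebesgue) \<longlonglongrightarrow> (\<integral>x. u x * v x \<partial>lebesgue))"

definition weak_star_tendsto_vec ::
    "(nat \<Rightarrow> real ^ 'n \<Rightarrow> real ^ 'm) \<Rightarrow> (real ^ 'n \<Rightarrow> real ^ 'm) \<Rightarrow> bool" where
  "weak_star_tendsto_vec U u \<longleftrightarrow>
     (\<forall>j. weak_star_tendsto (\<lambda>i x. U i x $ j) (\<lambda>x. u x $ j))"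

end

theory Submission
  imports Defs
begin

text \<open>
  The convex function \<open>f\<close> is, on \<open>K\<close>, the supremum of countably many affine functions
  \<open>a k \<bullet> w + b k\<close> (\<open>countable_affine_minorants\<close>): convexity gives the affine minorants by
  separating a point below the graph from the closure of the epigraph, and Lindelof's theorem
  makes them countably many. The zero function may be put among them because \<open>f \<ge> 0\<close>.

  Weak* convergence only speaks about integrals that are linear in the sequence, so it has to be
  used with one affine function at each point \<open>x\<close>. The one to use is chosen by the limit \<open>u\<close> and
  not by the sequence: among the first \<open>N + 1\<close> affine functions, \<open>x\<close> gets one that is largest at
  \<open>u x\<close>. On a set \<open>A\<close> of finite measure, its slope and offset are integrable functions of \<open>x\<close>,
  and hence legitimate test functions. So, with \<open>s x\<close> the chosen index, the integrals of
  \<open>a (s x) \<bullet> U i x + b (s x)\<close> over \<open>A\<close> converge to the integral of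
  \<open>a (s x) \<bullet> u x + b (s x)\<close>, whose integrand is the maximum of the first \<open>N + 1\<close> functions
  at \<open>u x\<close>. Along
  the sequence, the selected function may be far from the largest one at \<open>U i x\<close>, but it is below
  \<open>f (U i x)\<close> in any case, and that is the inequality wanted
  (\<open>nn_integral_affine_selection_le_liminf\<close>). Letting \<open>N\<close> grow and \<open>A\<close> exhaust \<open>\<Omega>\<close>, Fatou's
  lemma recovers the integral of \<open>f (u x)\<close> over \<open>\<Omega>\<close>.
\<close>

section \<open>Continuous convex functions as countable suprema of affine functions\<close>

text \<open>
  By continuity, a point strictly below the graph lies outside the closure of the epigraph. The hyperplane that
  separates them is not vertical, because \<open>w\<close> itself belongs to \<open>K\<close>, and so it is the graph of an
  affine function.
\<close>

lemma affine_minorant_above: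
  fixes f :: "'a::euclidean_space \<Rightarrow> real"
  assumes cvx: "convex_on K f" and cont: "continuous_on K f"
    and w: "w \<in> K" and t: "t < f w"
  shows "\<exists>a b. (\<forall>y\<in>K. a \<bullet> y + b \<le> f y) \<and> t < a \<bullet> w + b"
proof -
  let ?E = "closure (epigraph K f)"
  have "(w, t) \<notin> ?E"
  proof
    assume "(w, t) \<in> ?E"
    then obtain z where z: "\<And>n. z n \<in> epigraph K f" and lim: "z \<longlonglongrightarrow> (w, t)"
      unfolding closure_sequential by blast
    have l1: "(\<lambda>n. fst (z n)) \<longlonglongrightarrow> w" and l2: "(\<lambda>n. snd (z n)) \<longlonglongrightarrow> t"
      using tendsto_fst[OF lim] tendsto_snd[OF lim] by simp_all
    have "(\<lambda>n. f (fst (z n))) \<longlonglongrightarrow> f w"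
      by (rule continuous_on_tendsto_compose[OF cont l1 w]) (use z in \<open>auto simp: epigraph_def\<close>)
    then have "f w \<le> t"
      by (rule LIMSEQ_le[OF _ l2]) (use z in \<open>auto simp: epigraph_def\<close>)
    with t show False by simp
  qed
  moreover have "convex ?E"
    using cvx by (intro convex_closure) (simp add: convex_epigraph convex_on_imp_convex)
  ultimately obtain n c where n: "n \<bullet> (w, t) < c" "\<And>z. z \<in> ?E \<Longrightarrow> c < n \<bullet> z"
    using separating_hyperplane_closed_point[of ?E "(w, t)"] closed_closure by metis
  obtain p s where [simp]: "n = (p, s)" by (cases n)
  have sep: "c < p \<bullet> y + s * f y" if "y \<in> K" for y
  proof -
    have "(y, f y) \<in> ?E"
      using that by (intro subsetD[OF closure_subset]) (simp add: epigraph_def)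
    from n(2)[OF this] show ?thesis
      by (simp add: inner_prod_def)
  qed
  have low: "p \<bullet> w + s * t < c"
    using n(1) by (simp add: inner_prod_def)
  have "s * t < s * f w"
    using sep[OF w] low by linarith
  with t have s: "s > 0"
    by (smt (verit) mult_less_cancel_left)
  have "(- (1 / s) *\<^sub>R p) \<bullet> y + c / s \<le> f y" if "y \<in> K" for y
    using sep[OF that] s by (simp add: field_simps)
  moreover have "t < (- (1 / s) *\<^sub>R p) \<bullet> w + c / s"
    using low s by (simp add: field_simps)
  ultimately show ?thesis by blast
qed

text \<open>
  The open half-spaces below the affine minorants cover the region strictly below the graph of
  \<open>f\<close> over \<open>K\<close>, so by Lindelof's theorem countably many of them do. The zero function is placed at
  index \<open>0\<close>, so that the maximum of the first \<open>N + 1\<close> functions is nonnegative for every \<open>N\<close>.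
\<close>

lemma countable_affine_minorants:
  fixes f :: "'a::euclidean_space \<Rightarrow> real"
  assumes cvx: "convex_on K f" and cont: "continuous_on K f"
    and nonneg: "\<And>w. w \<in> K \<Longrightarrow> 0 \<le> f w"
  obtains a :: "nat \<Rightarrow> 'a" and b :: "nat \<Rightarrow> real"
  where "a 0 = 0" "b 0 = 0"
    and "\<And>k w. w \<in> K \<Longrightarrow> a k \<bullet> w + b k \<le> f w"
    and "\<And>w t. w \<in> K \<Longrightarrow> t < f w \<Longrightarrow> \<exists>k. t < a k \<bullet> w + b k"
proof -
  define M where "M = {(p, q). \<forall>w\<in>K. p \<bullet> w + q \<le> f w}"
  define H :: "'a \<times> real \<Rightarrow> ('a \<times> real) set" where "H = (\<lambda>(p, q). {(w, t). t < p \<bullet> w + q})"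
  have "open (H m)" for m
    unfolding H_def case_prod_beta
    by (intro open_Collect_less continuous_intros)
  then have "\<And>S. S \<in> H ` M \<Longrightarrow> open S"
    by blast
  then obtain \<H> where \<H>: "\<H> \<subseteq> H ` M" "countable \<H>" "\<Union>\<H> = \<Union>(H ` M)"
    by (rule Lindelof)
  then obtain C where C: "C \<subseteq> M" "countable C" "\<H> = H ` C"
    by (metis countable_subset_image)
  define D where "D = insert (0, 0) C"
  have D: "countable D" "D \<noteq> {}"
    using C by (auto simp: D_def)
  have DM: "D \<subseteq> M"
    using C nonneg by (auto simp: D_def M_def)
  define c where "c k = (case k of 0 \<Rightarrow> (0, 0) | Suc j \<Rightarrow> from_nat_into D j)" for k
  have cD: "c k \<in> D" for k
    using from_nat_into[OF D(2)] by (auto simp: c_def D_def split: nat.split)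
  show ?thesis
  proof
    show "fst (c 0) = 0" "snd (c 0) = 0"
      by (simp_all add: c_def)
    show "fst (c k) \<bullet> w + snd (c k) \<le> f w" if "w \<in> K" for k w
      using cD[of k] DM that by (auto simp: M_def)
    show "\<exists>k. t < fst (c k) \<bullet> w + snd (c k)" if wt: "w \<in> K" "t < f w" for w t
    proof -
      have "(w, t) \<in> \<Union>(H ` M)"
        using affine_minorant_above[OF cvx cont wt] by (force simp: H_def M_def)
      then have "(w, t) \<in> \<Union>(H ` C)"
        using \<H>(3) C(3) by simp
      then obtain m where m: "m \<in> C" "(w, t) \<in> H m"
        by blast
      then obtain j where "from_nat_into D j = m"
        using from_nat_into_surj[OF D(1), of m] by (auto simp: D_def)
      then have "c (Suc j) = m"
        by (simp add: c_def)
      with m show ?thesis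
        by (intro exI[of _ "Suc j"]) (auto simp: H_def)
    qed
  qed
qed

section \<open>Affine integrands under weak* convergence\<close>

lemma Linfty_times_integrable:
  assumes "u \<in> Linfty" and v: "integrable lebesgue v"
  shows "integrable lebesgue (\<lambda>x. u x * v x)"
proof -
  let ?s = "esssup lebesgue (\<lambda>x. ereal \<bar>u x\<bar>)"
  have [measurable]: "u \<in> borel_measurable lebesgue" and fin: "?s < \<infinity>"
    using assms by (auto simp: Linfty_def)
  have [measurable]: "v \<in> borel_measurable lebesgue"
    using v by auto
  obtain C where C: "?s \<le> ereal C"
    using fin by (cases ?s) auto
  have "AE x in lebesgue. ereal \<bar>u x\<bar> \<le> ?s"
    by (rule esssup_AE) measurable
  then have "AE x in lebesgue. norm (u x * v x) \<le> norm (C * \<bar>v x\<bar>)"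
  proof eventually_elim
    case (elim x)
    then have "\<bar>u x\<bar> \<le> C"
      using C by (metis ereal_less_eq(3) order_trans)
    then show ?case
      by (auto simp: abs_mult intro!: mult_right_mono)
  qed
  then show ?thesis
    by (rule Bochner_Integration.integrable_bound[rotated 2]) (use v in auto)
qed

lemma Linfty_vec_inner_integrable:
  fixes u :: "real ^ 'n \<Rightarrow> real ^ 'm"
  assumes "u \<in> Linfty_vec" and "\<And>j. integrable lebesgue (\<lambda>x. p x $ j)"
  shows "integrable lebesgue (\<lambda>x. p x \<bullet> u x)"
  using assms unfolding inner_vec_def Linfty_vec_def
  by (auto intro!: Bochner_Integration.integrable_sum Linfty_times_integrable
      simp: mult.commute[of "p _ $ _"])

lemma weak_star_tendsto_integral_affine:
  fixes U :: "nat \<Rightarrow> real ^ 'n \<Rightarrow> real ^ 'm"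
  assumes U: "\<And>i. U i \<in> Linfty_vec" and u: "u \<in> Linfty_vec"
    and weak: "weak_star_tendsto_vec U u"
    and p: "\<And>j. integrable lebesgue (\<lambda>x. p x $ j)" and q: "integrable lebesgue q"
  shows "(\<lambda>i. \<integral>x. p x \<bullet> U i x + q x \<partial>lebesgue) \<longlonglongrightarrow> (\<integral>x. p x \<bullet> u x + q x \<partial>lebesgue)"
proof -
  have split: "(\<integral>x. p x \<bullet> w x + q x \<partial>lebesgue)
      = (\<Sum>j\<in>UNIV. \<integral>x. w x $ j * p x $ j \<partial>lebesgue) + (\<integral>x. q x \<partial>lebesgue)"
    if w: "w \<in> Linfty_vec" for w
  proof -
    have "(\<integral>x. p x \<bullet> w x \<partial>lebesgue) = (\<integral>x. (\<Sum>j\<in>UNIV. w x $ j * p x $ j) \<partial>lebesgue)"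
      by (simp add: inner_vec_def mult.commute)
    also have "\<dots> = (\<Sum>j\<in>UNIV. \<integral>x. w x $ j * p x $ j \<partial>lebesgue)"
      using w p
      by (intro Bochner_Integration.integral_sum Linfty_times_integrable)
        (auto simp: Linfty_vec_def)
    finally show ?thesis
      using Linfty_vec_inner_integrable[OF w p] q by simp
  qed
  show ?thesis
    unfolding split[OF U] split[OF u]
    using weak p unfolding weak_star_tendsto_vec_def weak_star_tendsto_def
    by (intro tendsto_intros) auto
qed

text \<open>
  Since \<open>s\<close> takes finitely many values, the selected slopes and offsets are bounded and can be
  integrated over \<open>A\<close>; this makes them test functions for the weak* convergence. The selection
  depends on \<open>x\<close> but not on \<open>i\<close>, so the affine integrals converge, and each of them is bounded by
  the integral of \<open>f\<close> along the sequence.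
\<close>

lemma nn_integral_affine_selection_le_liminf:
  fixes U :: "nat \<Rightarrow> real ^ 'n \<Rightarrow> real ^ 'm" and a :: "nat \<Rightarrow> real ^ 'm" and b :: "nat \<Rightarrow> real"
  assumes U: "\<And>i. U i \<in> Linfty_vec" and u: "u \<in> Linfty_vec"
    and weak: "weak_star_tendsto_vec U u"
    and s [measurable]: "s \<in> measurable lebesgue (count_space UNIV)" and sN: "\<And>x. s x \<le> N"
    and A [measurable]: "A \<in> sets lebesgue" and fin: "emeasure lebesgue A < \<infinity>"
    and minor: "\<And>k i x. a k \<bullet> U i x + b k \<le> f (U i x)"
    and nonneg: "\<And>x. 0 \<le> a (s x) \<bullet> u x + b (s x)"
  shows "(\<integral>\<^sup>+x\<in>A. ennreal (a (s x) \<bullet> u x + b (s x)) \<partial>lebesgue)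
           \<le> liminf (\<lambda>i. \<integral>\<^sup>+x\<in>A. ennreal (f (U i x)) \<partial>lebesgue)"
proof -
  define p where "p x = indicat_real A x *\<^sub>R a (s x)" for x
  define q where "q x = indicat_real A x * b (s x)" for x
  have int_sel: "integrable lebesgue (\<lambda>x. indicat_real A x * h (s x))" for h :: "nat \<Rightarrow> real"
  proof (rule Bochner_Integration.integrable_bound)
    show "integrable lebesgue (\<lambda>x. (\<Sum>k\<le>N. \<bar>h k\<bar>) * indicat_real A x)"
      using fin by (intro integrable_mult_right integrable_real_indicator) auto
    show "(\<lambda>x. indicat_real A x * h (s x)) \<in> borel_measurable lebesgue"
      by measurable
    have "\<bar>h (s x)\<bar> \<le> (\<Sum>k\<le>N. \<bar>h k\<bar>)" for x
      using sN by (intro member_le_sum) auto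
    then show "AE x in lebesgue. norm (indicat_real A x * h (s x))
        \<le> norm ((\<Sum>k\<le>N. \<bar>h k\<bar>) * indicat_real A x)"
      by (auto simp: indicator_def intro!: order_trans[OF _ abs_ge_self])
  qed
  have p: "integrable lebesgue (\<lambda>x. p x $ j)" for j
    unfolding p_def using int_sel[of "\<lambda>k. a k $ j"] by simp
  have q: "integrable lebesgue q"
    unfolding q_def using int_sel[of b] by simp
  have int: "integrable lebesgue (\<lambda>x. p x \<bullet> w x + q x)" if "w \<in> Linfty_vec" for w
    using Linfty_vec_inner_integrable[OF that p] q by simp
  have pq: "p x \<bullet> w + q x = (a (s x) \<bullet> w + b (s x)) * indicat_real A x" for x w
    by (simp add: p_def q_def algebra_simps)
  have "(\<integral>\<^sup>+x\<in>A. ennreal (a (s x) \<bullet> u x + b (s x)) \<partial>lebesgue)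
      = (\<integral>\<^sup>+x. ennreal (p x \<bullet> u x + q x) \<partial>lebesgue)"
    by (intro nn_integral_cong) (auto simp: pq indicator_def)
  also have "\<dots> = ennreal (\<integral>x. p x \<bullet> u x + q x \<partial>lebesgue)"
    using nonneg by (intro nn_integral_eq_integral int u) (auto simp: pq)
  also have "\<dots> = liminf (\<lambda>i. ennreal (\<integral>x. p x \<bullet> U i x + q x \<partial>lebesgue))"
    using weak_star_tendsto_integral_affine[OF U u weak p q]
    by (intro lim_imp_Liminf[symmetric] tendsto_ennrealI) auto
  also have "\<dots> \<le> liminf (\<lambda>i. \<integral>\<^sup>+x\<in>A. ennreal (f (U i x)) \<partial>lebesgue)"
  proof (intro Liminf_mono always_eventually allI)
    fix i
    \<comment> \<open>Only at \<open>u\<close> is the affine integrand known to be nonnegative; at \<open>U i\<close>, \<open>ennreal\<close> cuts it off.\<close>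
    have "(\<integral>x. p x \<bullet> U i x + q x \<partial>lebesgue) \<le> (\<integral>x. max 0 (p x \<bullet> U i x + q x) \<partial>lebesgue)"
      by (intro integral_mono integrable_max int U) auto
    then have "ennreal (\<integral>x. p x \<bullet> U i x + q x \<partial>lebesgue)
        \<le> ennreal (\<integral>x. max 0 (p x \<bullet> U i x + q x) \<partial>lebesgue)"
      by (rule ennreal_leI)
    also have "\<dots> = (\<integral>\<^sup>+x. ennreal (max 0 (p x \<bullet> U i x + q x)) \<partial>lebesgue)"
      by (intro nn_integral_eq_integral[symmetric] integrable_max int U) auto
    also have "\<dots> \<le> (\<integral>\<^sup>+x\<in>A. ennreal (f (U i x)) \<partial>lebesgue)"
      using minor[of "s _" i]
      by (intro nn_integral_mono) (auto simp: pq indicator_def max_def intro!: ennreal_leI)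
    finally show "ennreal (\<integral>x. p x \<bullet> U i x + q x \<partial>lebesgue)
        \<le> (\<integral>\<^sup>+x\<in>A. ennreal (f (U i x)) \<partial>lebesgue)" .
  qed
  finally show ?thesis .
qed

section \<open>Weak* lower semicontinuity\<close>

theorem theorem4:
  fixes U :: "nat \<Rightarrow> real ^ 'n \<Rightarrow> real ^ 'm"
    and u :: "real ^ 'n \<Rightarrow> real ^ 'm"
    and K :: "(real ^ 'm) set"
    and f :: "real ^ 'm \<Rightarrow> real"
    and \<Omega> :: "(real ^ 'n) set"
  assumes "\<And>i. U i \<in> Linfty_vec"
    and "u \<in> Linfty_vec"
    and "weak_star_tendsto_vec U u"
    and "convex K"
    and "\<And>i x. U i x \<in> K"
    and "\<And>x. u x \<in> K"
    and "\<And>w. w \<in> K \<Longrightarrow> 0 \<le> f w"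
    and "continuous_on K f"
    and "convex_on K f"
    and "\<Omega> \<in> sets lebesgue"
  shows "liminf (\<lambda>i. \<integral>\<^sup>+x\<in>\<Omega>. ennreal (f (U i x)) \<partial>lebesgue)
           \<ge> (\<integral>\<^sup>+x\<in>\<Omega>. ennreal (f (u x)) \<partial>lebesgue)"
proof -
  note U = assms(1) and u = assms(2) and weak = assms(3) and UK = assms(5) and uK = assms(6)
  note [measurable] = assms(10)
  obtain a :: "nat \<Rightarrow> real ^ 'm" and b :: "nat \<Rightarrow> real"
    where zero: "a 0 = 0" "b 0 = 0"
      and minor: "\<And>k w. w \<in> K \<Longrightarrow> a k \<bullet> w + b k \<le> f w"
      and dense: "\<And>w t. w \<in> K \<Longrightarrow> t < f w \<Longrightarrow> \<exists>k. t < a k \<bullet> w + b k"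
    using countable_affine_minorants[OF assms(9,8,7)] by metis
  define g where "g k x = a k \<bullet> u x + b k" for k x
  have "(\<lambda>x. u x $ j) \<in> borel_measurable lebesgue" for j
    using u by (auto simp: Linfty_vec_def Linfty_def)
  then have [measurable]: "g k \<in> borel_measurable lebesgue" for k
    unfolding g_def inner_vec_def by measurable
  \<comment> \<open>The least maximising index, which makes the selection measurable.\<close>
  define s where "s N x = (LEAST k. k \<le> N \<and> (\<forall>j\<le>N. g j x \<le> g k x))" for N x
  have [measurable]: "s N \<in> measurable lebesgue (count_space UNIV)" for N
    unfolding s_def by measurable
  have s: "s N x \<le> N \<and> (\<forall>j\<le>N. g j x \<le> g (s N x) x)" for N x
  proof -
    have "Max ((\<lambda>k. g k x) ` {..N}) \<in> (\<lambda>k. g k x) ` {..N}"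
      by (rule Max_in) auto
    then obtain k where k: "k \<le> N" "Max ((\<lambda>k. g k x) ` {..N}) = g k x"
      by (metis (no_types, lifting) imageE atMost_iff)
    have "g j x \<le> g k x" if "j \<le> N" for j
      unfolding k(2)[symmetric] using that by (intro Max_ge) auto
    with k(1) have "\<exists>k. k \<le> N \<and> (\<forall>j\<le>N. g j x \<le> g k x)"
      by blast
    then show ?thesis
      unfolding s_def by (rule LeastI_ex)
  qed
  have nonneg: "0 \<le> g (s N x) x" for N x
    using s[of N x] zero by (force simp: g_def)
  define A where "A N = \<Omega> \<inter> cball 0 (real N)" for N
  have A [measurable]: "A N \<in> sets lebesgue" for N
    unfolding A_def by auto
  have fin: "emeasure lebesgue (A N) < \<infinity>" for N
  proof -
    have "emeasure lebesgue (A N) \<le> emeasure lebesgue (cball (0 :: real ^ 'n) (real N))"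
      unfolding A_def by (intro emeasure_mono) auto
    also have "\<dots> < \<infinity>"
      using emeasure_lborel_cball_finite by simp
    finally show ?thesis .
  qed
  let ?L = "liminf (\<lambda>i. \<integral>\<^sup>+x\<in>\<Omega>. ennreal (f (U i x)) \<partial>lebesgue)"
  have bound: "(\<integral>\<^sup>+x\<in>A N. ennreal (g (s N x) x) \<partial>lebesgue) \<le> ?L" for N
  proof -
    have "(\<integral>\<^sup>+x\<in>A N. ennreal (g (s N x) x) \<partial>lebesgue)
        \<le> liminf (\<lambda>i. \<integral>\<^sup>+x\<in>A N. ennreal (f (U i x)) \<partial>lebesgue)"
      unfolding g_def
      by (rule nn_integral_affine_selection_le_liminf[OF U u weak, where N = N])
        (use s minor UK fin nonneg in \<open>auto simp: g_def\<close>)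
    also have "\<dots> \<le> ?L"
      by (intro Liminf_mono always_eventually allI nn_integral_mono)
        (auto simp: A_def indicator_def)
    finally show ?thesis .
  qed
  have pointwise: "(\<lambda>N. ennreal (g (s N x) x) * indicator (A N) x)
      \<longlonglongrightarrow> ennreal (f (u x)) * indicator \<Omega> x" for x
  proof (cases "x \<in> \<Omega>")
    case True
    have "(\<lambda>N. g (s N x) x) \<longlonglongrightarrow> f (u x)"
    proof (rule order_tendstoI)
      fix t assume "t < f (u x)"
      then obtain k where "t < g k x"
        using dense[OF uK] unfolding g_def by blast
      then show "\<forall>\<^sub>F N in sequentially. t < g (s N x) x"
        using s by (intro eventually_sequentiallyI[of k]) (meson less_le_trans)
    next
      fix t assume "f (u x) < t"
      then show "\<forall>\<^sub>F N in sequentially. g (s N x) x < t"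
        using le_less_trans[OF minor[OF uK]] unfolding g_def by (intro always_eventually allI)
    qed
    then have "(\<lambda>N. ennreal (g (s N x) x)) \<longlonglongrightarrow> ennreal (f (u x))"
      by (rule tendsto_ennrealI)
    moreover have "\<forall>\<^sub>F N in sequentially.
        ennreal (g (s N x) x) = ennreal (g (s N x) x) * indicator (A N) x"
    proof (rule eventually_sequentiallyI)
      fix N assume "nat \<lceil>norm x\<rceil> \<le> N"
      then have "norm x \<le> real N" by linarith
      with True show "ennreal (g (s N x) x) = ennreal (g (s N x) x) * indicator (A N) x"
        by (simp add: A_def)
    qed
    ultimately show ?thesis
      using True by (simp add: tendsto_cong)
  qed (simp add: A_def)
  have "(\<integral>\<^sup>+x\<in>\<Omega>. ennreal (f (u x)) \<partial>lebesgue)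
      = (\<integral>\<^sup>+x. liminf (\<lambda>N. ennreal (g (s N x) x) * indicator (A N) x) \<partial>lebesgue)"
    by (intro nn_integral_cong lim_imp_Liminf[symmetric] pointwise) simp
  also have "\<dots> \<le> liminf (\<lambda>N. \<integral>\<^sup>+x\<in>A N. ennreal (g (s N x) x) \<partial>lebesgue)"
    by (rule nn_integral_liminf) measurable
  also have "\<dots> \<le> liminf (\<lambda>N::nat. ?L)"
    using bound by (intro Liminf_mono) simp
  also have "\<dots> = ?L"
    by (simp add: Liminf_const)
  finally show ?thesis .
qed

end
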